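(* Let $(S_n)_{n\in\mathbb Z_+}$ be a sequence of finite or countably infinite state spaces and let $(Z_n)_{n\in\mathbb Z_+}$ be a (possibly nonhomogeneous) Markov chain on a probability space $(\Omega,\mathcal F,P)$, with $Z_n$ taking values in $S_n$. Let $A\in\mathcal T=\bigcap_{n\ge 0}\sigma(Z_n,Z_{n+1},\dots)$ and, for $0\le a\le b\le 1$, let $S_n(a,b)=\{i\in S_n: a\le P(A\mid Z_n=i)\le b\}$. If $0<p<q<1$, then: a) $\lim_{n\to\infty}P(Z_n\in S_n(q,1))=P(A)$, b) $\lim_{n\to\infty}P(Z_n\in S_n(p,q))=0$, and c) $\lim_{n\to\infty}P(Z_n\in S_n(0,p))=1-P(A)$.
   Context: $\mathbb Z_+=\{0,1,2,\dots\}$. A Markov chain here means a sequence of random variables $(Z_n)$ satisfying the Markov property, i.e. $P(Z_{n+1}=j\mid Z_0=i_0,\dots,Z_n=i_n)=P(Z_{n+1}=j\mid Z_n=i_n)$ whenever the conditioning event on the left has positive probability. No assumption is made on the initial distribution or on the transition probabilities, which may depend on $n$. The state spaces carry the discrete $\sigma$-algebra. $P(A\mid Z_n=i)$ is the elementary conditional probability; states $i$ with $P(Z_n=i)=0$ play no role, since they do not affect the probabilities in the conclusion. *)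

theory Defs
  imports "HOL-Probability.Probability"
begin

text \<open>
  The state spaces are subsets \<open>S n\<close> of one type, each carrying the discrete
  \<open>\<sigma>\<close>-algebra. Initial law and transition probabilities are unrestricted,
  and the latter may depend on \<open>n\<close>.
\<close>

definition markov_chain ::
    "'a measure \<Rightarrow> (nat \<Rightarrow> 's set) \<Rightarrow> (nat \<Rightarrow> 'a \<Rightarrow> 's) \<Rightarrow> bool" where
  "markov_chain M S Z \<longleftrightarrow>
     (\<forall>n. Z n \<in> measurable M (count_space (S n))) \<and>
     (\<forall>n i. \<forall>j\<in>S (Suc n).
        (\<forall>k\<le>n. i k \<in> S k) \<longrightarrow>
        \<P>(\<omega> in M. \<forall>k\<le>n. Z k \<omega> = i k) > 0 \<longrightarrow>
        \<P>(\<omega> in M. Z (Suc n) \<omega> = j \<bar> \<forall>k\<le>n. Z k \<omega> = i k) =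
        \<P>(\<omega> in M. Z (Suc n) \<omega> = j \<bar> Z n \<omega> = i n))"

definition process_tail_events ::
    "'a measure \<Rightarrow> (nat \<Rightarrow> 's set) \<Rightarrow> (nat \<Rightarrow> 'a \<Rightarrow> 's) \<Rightarrow> 'a set set" where
  "process_tail_events M S Z =
     prob_space.tail_events M
       (\<lambda>n. sets (vimage_algebra (space M) (Z n) (count_space (S n))))"

text \<open>
  The set \<open>S\<^sub>n(a,b)\<close> of states \<open>i\<close> with \<open>a \<le> P(A | Z\<^sub>n = i) \<le> b\<close>. If
  \<open>P(Z\<^sub>n = i) = 0\<close>, division by zero makes the conditional probability \<open>0\<close>;
  since \<open>S n\<close> is countable, such states do not affect the probability that
  \<open>Z\<^sub>n\<close> lies in this set.
\<close>

definition cond_prob_states ::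
    "'a measure \<Rightarrow> (nat \<Rightarrow> 's set) \<Rightarrow> (nat \<Rightarrow> 'a \<Rightarrow> 's) \<Rightarrow> 'a set \<Rightarrow>
       nat \<Rightarrow> real \<Rightarrow> real \<Rightarrow> 's set" where
  "cond_prob_states M S Z A n a b =
     {i \<in> S n. a \<le> \<P>(\<omega> in M. \<omega> \<in> A \<bar> Z n \<omega> = i) \<and>
               \<P>(\<omega> in M. \<omega> \<in> A \<bar> Z n \<omega> = i) \<le> b}"

end

theory Submission
  imports Defs
begin

text \<open>
  Let \<open>f n s = P(A | Z n = s)\<close>. The Markov property in its full form, conditional
  independence of the past up to time \<open>n\<close> and the future from time \<open>n\<close> on given \<open>Z n\<close>,
  says that \<open>P(A \<inter> G \<inter> {Z n = s}) = f n s * P(G \<inter> {Z n = s})\<close> for every past event \<open>G\<close>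
  (\<open>future_given_past\<close>); here it matters that \<open>A\<close>, being a tail event, belongs to the
  future of every time. On the other hand \<open>A\<close> is determined by the whole process, so for
  \<open>\<epsilon> > 0\<close> there is an event \<open>B\<close>, depending on finitely many coordinates only, whose
  symmetric difference with \<open>A\<close> has probability below \<open>\<epsilon>\<close>
  (\<open>approximation_in_filtration\<close>). From some time on, \<open>B\<close> belongs to the past.

  Fix a threshold \<open>0 < c < 1\<close> and let \<open>D\<close> be the event that \<open>f n (Z n) \<ge> c\<close>. On the past
  event \<open>D - B\<close> the chain is in states given which \<open>A\<close> has probability at least \<open>c\<close>, whence
  \<open>c * P(D - B) \<le> P(A \<inter> (D - B)) \<le> P(A - B)\<close>. Symmetrically,
  \<open>(1 - c) * P(B - D) \<le> P((B - D) - A) \<le> P(B - A)\<close>. So \<open>D\<close> is close to \<open>B\<close>, hence to \<open>A\<close>, and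
  \<open>P(D)\<close> tends to \<open>P(A)\<close> as \<open>n\<close> grows (\<open>prob_threshold_tendsto\<close>). The same holds for the
  strict threshold \<open>f n (Z n) > c\<close>, and the three limits follow by taking complements and
  differences of threshold events. This replaces the convergence theorem for the martingale
  \<open>P(A | Z 0, \<dots>, Z n)\<close> by an elementary estimate.
\<close>

section \<open>Events in a probability space\<close>

context prob_space
begin

lemma prob_sym_diff_triangle:
  assumes "X \<in> events" "Y \<in> events" "W \<in> events"
  shows "prob (sym_diff X W) \<le> prob (sym_diff X Y) + prob (sym_diff Y W)"
proof -
  have "prob (sym_diff X W) \<le> prob (sym_diff X Y \<union> sym_diff Y W)"
    using assms by (intro finite_measure_mono) auto
  also have "\<dots> \<le> prob (sym_diff X Y) + prob (sym_diff Y W)"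
    using assms by (intro measure_Un_le) auto
  finally show ?thesis .
qed

lemma abs_prob_diff_le_prob_sym_diff:
  assumes "X \<in> events" "Y \<in> events"
  shows "\<bar>prob X - prob Y\<bar> \<le> prob (sym_diff X Y)"
proof -
  have "prob U \<le> prob V + prob (sym_diff U V)" if "U \<in> events" "V \<in> events" for U V
  proof -
    have "prob U \<le> prob (V \<union> sym_diff U V)"
      using that by (intro finite_measure_mono) auto
    also have "\<dots> \<le> prob V + prob (sym_diff U V)"
      using that by (intro measure_Un_le) auto
    finally show ?thesis .
  qed
  from this[of X Y] this[of Y X] assms show ?thesis
    by (simp add: Un_commute abs_le_iff)
qed

text \<open>
  The events that can be approximated form a \<open>\<sigma>\<close>-algebra: a countable union is, up to
  an event of small probability, a finite union, and finitely many approximations all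
  lie in one \<open>F n\<close>.
\<close>

lemma approximation_in_filtration:
  assumes alg: "\<And>n::nat. sigma_algebra (space M) (F n)"
    and sub: "\<And>n. F n \<subseteq> events"
    and mono: "\<And>m n. m \<le> n \<Longrightarrow> F m \<subseteq> F n"
    and X: "X \<in> sigma_sets (space M) (\<Union>n. F n)"
    and e: "0 < e"
  obtains n B where "B \<in> F n" "prob (sym_diff X B) < e"
proof -
  interpret F: sigma_algebra "space M" "F n" for n by (rule alg)
  have events: "Y \<in> events" if "Y \<in> sigma_sets (space M) (\<Union>n. F n)" for Y
  proof -
    have "(\<Union>n. F n) \<subseteq> events" using sub by blast
    then show ?thesis using that sets.sigma_sets_subset by blast
  qed
  have "\<forall>e>0. \<exists>n. \<exists>B\<in>F n. prob (sym_diff X B) < e"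
    using X
  proof (induction rule: sigma_sets.induct)
    case (Basic a)
    then obtain n where "a \<in> F n" by blast
    moreover have "prob (sym_diff a a) = 0" by simp
    ultimately show ?case by (intro allI impI exI[of _ n] bexI[of _ a]) simp_all
  next
    case Empty
    show ?case by (intro allI impI exI[of _ 0] bexI[of _ "{}"]) simp_all
  next
    case (Compl a)
    show ?case
    proof (intro allI impI)
      fix e :: real assume "0 < e"
      then obtain n B where B: "B \<in> F n" "prob (sym_diff a B) < e"
        using Compl.IH by blast
      have "a \<subseteq> space M" "B \<subseteq> space M"
        using events[OF Compl.hyps] sub B sets.sets_into_space by blast+
      then have "sym_diff (space M - a) (space M - B) = sym_diff a B" by auto
      moreover have "space M - B \<in> F n"
        using B(1) by (rule F.compl_sets)
      ultimately show "\<exists>n. \<exists>B\<in>F n. prob (sym_diff (space M - a) B) < e"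
        using B(2) by (intro exI[of _ n] bexI[of _ "space M - B"]) simp_all
    qed
  next
    case (Union a)
    note a = events[OF Union.hyps]
    define U where "U N = (\<Union>i<N. a i)" for N
    have U: "U N \<in> events" for N
      using a by (auto simp: U_def)
    have finite: "\<forall>e>0. \<exists>n. \<exists>B\<in>F n. prob (sym_diff (U N) B) < e" for N
    proof (induction N)
      case 0
      show ?case by (intro allI impI exI[of _ 0] bexI[of _ "{}"]) (simp_all add: U_def)
    next
      case (Suc N)
      show ?case
      proof (intro allI impI)
        fix e :: real assume "0 < e"
        then have "0 < e / 2" by simp
        obtain m C where C: "C \<in> F m" "prob (sym_diff (U N) C) < e / 2"
          using Suc.IH \<open>0 < e / 2\<close> by meson
        obtain n D where D: "D \<in> F n" "prob (sym_diff (a N) D) < e / 2"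
          using Union.IH[of N] \<open>0 < e / 2\<close> by meson
        have CD: "C \<in> events" "D \<in> events" using C D sub by auto
        have "C \<in> F (max m n)" "D \<in> F (max m n)"
          using C(1) D(1) subsetD[OF mono[OF max.cobounded1]] subsetD[OF mono[OF max.cobounded2]]
          by simp_all
        then have "C \<union> D \<in> F (max m n)"
          by (rule F.Un)
        moreover have "prob (sym_diff (U (Suc N)) (C \<union> D)) < e"
        proof -
          have "prob (sym_diff (U (Suc N)) (C \<union> D))
              \<le> prob (sym_diff (U N) C \<union> sym_diff (a N) D)"
            using U[of N] a CD
            by (intro finite_measure_mono) (auto simp: U_def less_Suc_eq)
          also have "\<dots> \<le> prob (sym_diff (U N) C) + prob (sym_diff (a N) D)"
            using U a CD by (intro measure_Un_le) auto
          finally show ?thesis using C D by simp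
        qed
        ultimately show "\<exists>n. \<exists>B\<in>F n. prob (sym_diff (U (Suc N)) B) < e" by blast
      qed
    qed
    show ?case
    proof (intro allI impI)
      fix e :: real assume "0 < e"
      then have e2: "0 < e / 2" by simp
      have UN: "(\<Union>N. U N) = (\<Union>i. a i)" by (auto simp: U_def)
      have lim: "(\<lambda>N. prob (U N)) \<longlonglongrightarrow> prob (\<Union>i. a i)"
        unfolding UN[symmetric]
      proof (rule finite_Lim_measure_incseq)
        show "range U \<subseteq> events" using U by auto
        show "incseq U" unfolding incseq_def U_def by (intro allI impI UN_mono) auto
      qed
      have "\<forall>\<^sub>F N in sequentially. prob (\<Union>i. a i) - e / 2 < prob (U N)"
        using lim by (rule order_tendstoD) (use e2 in simp)
      then obtain N where N: "prob (\<Union>i. a i) - e / 2 < prob (U N)"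
        by (metis eventually_happens trivial_limit_sequentially)
      have aU: "(\<Union>i. a i) \<in> events" using a by auto
      have "sym_diff (\<Union>i. a i) (U N) = (\<Union>i. a i) - U N" by (auto simp: U_def)
      moreover have "prob ((\<Union>i. a i) - U N) = prob (\<Union>i. a i) - prob (U N)"
        using U aU by (intro finite_measure_Diff) (auto simp: U_def)
      ultimately have 1: "prob (sym_diff (\<Union>i. a i) (U N)) < e / 2"
        using N by simp
      from finite e2 obtain n B where B: "B \<in> F n" "prob (sym_diff (U N) B) < e / 2"
        by blast
      have "prob (sym_diff (\<Union>i. a i) B) < e"
        using prob_sym_diff_triangle[OF aU U[of N] subsetD[OF sub B(1)]] B(2) 1 by linarith
      then show "\<exists>n. \<exists>B\<in>F n. prob (sym_diff (\<Union>i. a i) B) < e" using B by blast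
    qed
  qed
  then show ?thesis using e that by blast
qed

text \<open>
  Both sides of the product rule are additive in \<open>X\<close>, and the hypothesis on \<open>E\<close> and \<open>H\<close>
  is the rule for the sure event, so the events satisfying it form a Dynkin system.
\<close>

lemma product_rule_extends_to_sigma_sets:
  assumes stable: "Int_stable \<C>" and sub: "\<C> \<subseteq> events"
    and E: "E \<in> events" and H: "H \<in> events"
    and total: "prob (E \<inter> H) = c * prob E"
    and basic: "\<And>X. X \<in> \<C> \<Longrightarrow> prob (X \<inter> E \<inter> H) = c * prob (X \<inter> E)"
    and X: "X \<in> sigma_sets (space M) \<C>"
  shows "prob (X \<inter> E \<inter> H) = c * prob (X \<inter> E)"
proof -
  have pow: "\<C> \<subseteq> Pow (space M)"
    using sub sets.sets_into_space by blast
  have events: "Y \<in> events" if "Y \<in> sigma_sets (space M) \<C>" for Y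
    using that sets.sigma_sets_subset[OF sub] by blast
  show ?thesis
    using stable pow X
  proof (induction rule: sigma_sets_induct_disjoint)
    case (basic A)
    then show ?case by (rule assms(6))
  next
    case empty
    show ?case by simp
  next
    case (compl A)
    note A = events[OF compl.hyps]
    have *: "(space M - A) \<inter> G = G - A \<inter> G" if "G \<in> events" for G
      using sets.sets_into_space[OF that] by auto
    have "prob ((space M - A) \<inter> G) = prob G - prob (A \<inter> G)" if "G \<in> events" for G
      unfolding *[OF that] using A that by (intro finite_measure_Diff) auto
    from this[of E] this[of "E \<inter> H"] show ?case
      using E H compl.IH unfolding Int_assoc total by (simp add: right_diff_distrib)
  next
    case (union A)
    have A: "A i \<in> events" for i
      using union.hyps events by blast
    have *: "(\<lambda>i. prob (A i \<inter> G)) sums prob ((\<Union>i. A i) \<inter> G)" if "G \<in> events" for G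
    proof -
      have "(\<lambda>i. prob (A i \<inter> G)) sums prob (\<Union>i. A i \<inter> G)"
        using A that union.hyps(1)
        by (intro finite_measure_UNION) (auto simp: disjoint_family_on_def)
      then show ?thesis by simp
    qed
    have "(\<lambda>i. prob (A i \<inter> (E \<inter> H))) sums prob ((\<Union>i. A i) \<inter> (E \<inter> H))"
      using E H by (intro *) auto
    then have "(\<lambda>i. c * prob (A i \<inter> E)) sums prob ((\<Union>i. A i) \<inter> (E \<inter> H))"
      using union.IH by (simp add: Int_assoc)
    from sums_unique2[OF this sums_mult[OF *[OF E]]] show ?case
      by (simp add: Int_assoc)
  qed
qed

text \<open>
  Summing over the values of a discrete random variable turns inequalities between the
  parts of two events into one between their probabilities.
\<close>

lemma prob_le_by_countable_fibres:
  assumes T: "countable T" and X: "X \<in> measurable M (count_space T)"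
    and G: "G \<in> events" and H: "H \<in> events" and c: "0 \<le> c"
    and fibres: "\<And>s. s \<in> T \<Longrightarrow> c * prob (G \<inter> {\<omega> \<in> space M. X \<omega> = s})
                                 \<le> prob (H \<inter> {\<omega> \<in> space M. X \<omega> = s})"
  shows "c * prob G \<le> prob H"
proof -
  have total: "ennreal (prob K) = (\<integral>\<^sup>+s. prob (K \<inter> {\<omega> \<in> space M. X \<omega> = s}) \<partial>count_space T)"
    if K: "K \<in> events" for K
  proof -
    have fib: "{\<omega> \<in> space M. \<omega> \<in> K \<and> X \<omega> = s} = K \<inter> {\<omega> \<in> space M. X \<omega> = s}" for s
      using sets.sets_into_space[OF K] by auto
    have meas: "K \<inter> {\<omega> \<in> space M. X \<omega> = s} \<in> events" if "s \<in> T" for s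
    proof -
      have "X -` {s} \<inter> space M \<in> events"
        using measurable_sets[OF X, of "{s}"] that by auto
      also have "X -` {s} \<inter> space M = {\<omega> \<in> space M. X \<omega> = s}" by auto
      finally show ?thesis using K by auto
    qed
    have "{\<omega> \<in> space M. \<exists>s\<in>T. \<omega> \<in> K \<and> X \<omega> = s} = K"
      using measurable_space[OF X] sets.sets_into_space[OF K] by auto
    then show ?thesis
      using prob_EX_countable[of T "\<lambda>s \<omega>. \<omega> \<in> K \<and> X \<omega> = s"] meas T
      by (simp add: fib)
  qed
  have "ennreal (c * prob G)
      = ennreal c * (\<integral>\<^sup>+s. prob (G \<inter> {\<omega> \<in> space M. X \<omega> = s}) \<partial>count_space T)"
    using c by (simp add: ennreal_mult total[OF G])
  also have "\<dots> = (\<integral>\<^sup>+s. c * prob (G \<inter> {\<omega> \<in> space M. X \<omega> = s}) \<partial>count_space T)"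
    using c by (subst nn_integral_cmult[symmetric]) (auto simp: ennreal_mult)
  also have "\<dots> \<le> (\<integral>\<^sup>+s. prob (H \<inter> {\<omega> \<in> space M. X \<omega> = s}) \<partial>count_space T)"
    using fibres by (intro nn_integral_mono) (auto intro: ennreal_leI)
  also have "\<dots> = ennreal (prob H)"
    by (rule total[OF H, symmetric])
  finally show ?thesis by simp
qed

end

section \<open>Observing a process over a window of times\<close>

locale countable_state_process = prob_space M
  for M :: "'a measure" +
  fixes S :: "nat \<Rightarrow> 's set" and Z :: "nat \<Rightarrow> 'a \<Rightarrow> 's"
  assumes countable_states: "countable (S n)"
    and measurable_process: "Z n \<in> measurable M (count_space (S n))"
begin

definition observable :: "nat set \<Rightarrow> 'a set set" where
  "observable J = sigma_sets (space M)
     (\<Union>k\<in>J. sets (vimage_algebra (space M) (Z k) (count_space (S k))))"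

definition path_event :: "nat set \<Rightarrow> (nat \<Rightarrow> 's) \<Rightarrow> 'a set" where
  "path_event J i = {\<omega> \<in> space M. \<forall>k\<in>J. Z k \<omega> = i k}"

text \<open>
  For Dynkin arguments \<open>\<J>\<close> will be a chain of finite windows: a single one for the past,
  growing ones for the future, so that each longer path event refines the shorter ones.
  The empty event is included because two paths that disagree somewhere have disjoint
  path events.
\<close>

definition path_events :: "nat set set \<Rightarrow> 'a set set" where
  "path_events \<J> = insert {} {path_event J i | J i. J \<in> \<J> \<and> (\<forall>k\<in>J. i k \<in> S k)}"

lemma process_in_states: "\<omega> \<in> space M \<Longrightarrow> Z n \<omega> \<in> S n"
  using measurable_space[OF measurable_process] by auto

lemma process_sets:
  "sets (vimage_algebra (space M) (Z k) (count_space (S k)))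
     = {Z k -` B \<inter> space M | B. B \<subseteq> S k}"
  by (subst sets_vimage_algebra2) (auto simp: process_in_states)

lemma preimage_event: "{\<omega> \<in> space M. Z n \<omega> \<in> B} \<in> events"
proof -
  have "Z n -` (B \<inter> S n) \<inter> space M \<in> events"
    by (rule measurable_sets[OF measurable_process]) auto
  also have "Z n -` (B \<inter> S n) \<inter> space M = {\<omega> \<in> space M. Z n \<omega> \<in> B}"
    using process_in_states by auto
  finally show ?thesis .
qed

lemma state_event: "{\<omega> \<in> space M. Z n \<omega> = s} \<in> events"
  using preimage_event[of n "{s}"] by simp

lemma path_event_in_events: "path_event J i \<in> events"
proof -
  have "{\<omega> \<in> space M. \<forall>k\<in>J. Z k \<omega> = i k} \<in> events"
    by (rule sets.sets_Collect_countable_Ball) (auto intro: state_event)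
  then show ?thesis by (simp add: path_event_def)
qed

lemma generator_subset:
  "(\<Union>k\<in>J. sets (vimage_algebra (space M) (Z k) (count_space (S k)))) \<subseteq> Pow (space M)"
  by (auto simp: process_sets)

lemma sigma_algebra_observable: "sigma_algebra (space M) (observable J)"
  unfolding observable_def by (rule sigma_algebra_sigma_sets[OF generator_subset])

lemma observable_mono: "J \<subseteq> K \<Longrightarrow> observable J \<subseteq> observable K"
  unfolding observable_def by (rule sigma_sets_mono') auto

lemma observable_events: "observable J \<subseteq> events"
  unfolding observable_def
  by (rule sets.sigma_sets_subset)
     (auto intro!: measurable_sets[OF measurable_process] simp: process_sets)

lemma observable_Diff:
  "X \<in> observable J \<Longrightarrow> Y \<in> observable J \<Longrightarrow> X - Y \<in> observable J"
  using ring_of_sets.Diff algebra.axioms(1) sigma_algebra.axioms(1) sigma_algebra_observable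
  by metis

lemma observable_Int:
  "X \<in> observable J \<Longrightarrow> Y \<in> observable J \<Longrightarrow> X \<inter> Y \<in> observable J"
  using semiring_of_sets.Int ring_of_sets.axioms(1) algebra.axioms(1)
    sigma_algebra.axioms(1) sigma_algebra_observable
  by metis

lemma preimage_observable: "k \<in> J \<Longrightarrow> {\<omega> \<in> space M. Z k \<omega> \<in> B} \<in> observable J"
proof -
  assume k: "k \<in> J"
  have "{\<omega> \<in> space M. Z k \<omega> \<in> B} = Z k -` (B \<inter> S k) \<inter> space M"
    using process_in_states by auto
  then show ?thesis
    unfolding observable_def using k
    by (intro sigma_sets.Basic UN_I[of k]) (auto simp only: process_sets)
qed

lemma path_event_observable:
  assumes "finite J" "J \<subseteq> K"
  shows "path_event J i \<in> observable K"
  using assms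
proof (induction J)
  case empty
  have "path_event {} i = space M" by (simp add: path_event_def)
  then show ?case unfolding observable_def by (simp add: sigma_sets_top)
next
  case (insert k J)
  have "path_event (insert k J) i = {\<omega> \<in> space M. Z k \<omega> \<in> {i k}} \<inter> path_event J i"
    by (auto simp: path_event_def)
  then show ?case
    using insert preimage_observable[of k K "{i k}"] observable_Int by auto
qed

lemma path_events_in_events: "path_events \<J> \<subseteq> events"
  by (auto simp: path_events_def path_event_in_events)

lemma Int_stable_path_events:
  assumes chain: "\<And>J K. J \<in> \<J> \<Longrightarrow> K \<in> \<J> \<Longrightarrow> J \<subseteq> K \<or> K \<subseteq> J"
  shows "Int_stable (path_events \<J>)"
proof (rule Int_stableI)
  have nested: "path_event J i \<inter> path_event K j \<in> {{}, path_event K j}" if "J \<subseteq> K" for J K i j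
  proof (cases "\<forall>k\<in>J. i k = j k")
    case True
    then show ?thesis using that by (auto simp: path_event_def)
  next
    case False
    then show ?thesis using that by (auto simp: path_event_def) (metis subsetD)
  qed
  fix X Y assume X: "X \<in> path_events \<J>" and Y: "Y \<in> path_events \<J>"
  show "X \<inter> Y \<in> path_events \<J>"
  proof (cases "X = {} \<or> Y = {}")
    case True
    then show ?thesis by (auto simp: path_events_def)
  next
    case False
    then obtain J i K j where J: "J \<in> \<J>" "X = path_event J i"
      and K: "K \<in> \<J>" "Y = path_event K j"
      using X Y by (auto simp: path_events_def)
    have "X \<inter> Y \<in> {{}, X, Y}"
      using chain[OF J(1) K(1)] nested[of J K i j] nested[of K J j i] J(2) K(2)
      by (auto simp: Int_commute)
    then show ?thesis using X Y by (auto simp: path_events_def)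
  qed
qed

text \<open>
  An event about a single time is the union of all paths over a finite window containing
  that time that realise it; the state spaces being countable, there are only countably
  many such paths.
\<close>

lemma observable_subset_sigma_path_events:
  assumes finite: "\<And>J. J \<in> \<J> \<Longrightarrow> finite J" and cover: "K \<subseteq> \<Union>\<J>"
  shows "observable K \<subseteq> sigma_sets (space M) (path_events \<J>)"
  unfolding observable_def
proof (rule sigma_sets_mono, rule UN_least, rule subsetI)
  fix k Y assume k: "k \<in> K"
    and "Y \<in> sets (vimage_algebra (space M) (Z k) (count_space (S k)))"
  then obtain B where B: "Y = Z k -` B \<inter> space M" by (auto simp: process_sets)
  obtain J where J: "J \<in> \<J>" "k \<in> J" using k cover by auto
  define W where "W = {w \<in> Pi\<^sub>E J S. w k \<in> B}"
  have "Y = (\<Union>w\<in>W. path_event J w)"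
  proof safe
    fix \<omega> assume "\<omega> \<in> Y"
    then have "restrict (\<lambda>k. Z k \<omega>) J \<in> W" "\<omega> \<in> path_event J (restrict (\<lambda>k. Z k \<omega>) J)"
      using J(2) by (auto simp: B W_def path_event_def process_in_states)
    then show "\<omega> \<in> (\<Union>w\<in>W. path_event J w)" by blast
  next
    fix \<omega> w assume "w \<in> W" "\<omega> \<in> path_event J w"
    then show "\<omega> \<in> Y" using J(2) by (auto simp: B W_def path_event_def)
  qed
  also have "\<dots> \<in> sigma_sets (space M) (path_events \<J>)"
  proof (rule sigma_algebra.countable_UN'[OF sigma_algebra_sigma_sets])
    show "path_events \<J> \<subseteq> Pow (space M)"
      using path_events_in_events sets.sets_into_space by blast
    have "countable (Pi\<^sub>E J S)"
      using finite[OF J(1)] countable_states by (intro countable_PiE) auto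
    then show "countable W" unfolding W_def by (rule countable_subset[rotated]) auto
    show "path_event J ` W \<subseteq> sigma_sets (space M) (path_events \<J>)"
      using J(1) by (auto intro!: sigma_sets.Basic simp: path_events_def W_def PiE_iff)
  qed
  finally show "Y \<in> sigma_sets (space M) (path_events \<J>)" .
qed

end

section \<open>The Markov property for the entire past and future\<close>

locale countable_markov_chain = countable_state_process M S Z
  for M :: "'a measure" and S :: "nat \<Rightarrow> 's set" and Z :: "nat \<Rightarrow> 'a \<Rightarrow> 's" +
  assumes markov: "markov_chain M S Z"
begin

lemma markov_step:
  assumes "\<forall>k\<le>n. i k \<in> S k" "j \<in> S (Suc n)" "\<P>(\<omega> in M. \<forall>k\<le>n. Z k \<omega> = i k) > 0"
  shows "\<P>(\<omega> in M. Z (Suc n) \<omega> = j \<bar> \<forall>k\<le>n. Z k \<omega> = i k)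
       = \<P>(\<omega> in M. Z (Suc n) \<omega> = j \<bar> Z n \<omega> = i n)"
  using markov assms by (simp add: markov_chain_def)

text \<open>
  For \<open>G\<close> the event of a single path, this is the defining property of a Markov chain;
  path events over \<open>{..n}\<close> form a \<open>\<pi>\<close>-system generating the past.
\<close>

lemma transition_given_past:
  assumes G: "G \<in> observable {..n}" and t: "t \<in> S (Suc n)"
  shows "prob (G \<inter> {\<omega> \<in> space M. Z n \<omega> = s} \<inter> {\<omega> \<in> space M. Z (Suc n) \<omega> = t})
       = \<P>(\<omega> in M. Z (Suc n) \<omega> = t \<bar> Z n \<omega> = s) * prob (G \<inter> {\<omega> \<in> space M. Z n \<omega> = s})"
    (is "prob (G \<inter> ?E \<inter> ?H) = ?c * _")
proof (rule product_rule_extends_to_sigma_sets)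
  show "Int_stable (path_events {{..n}})"
    by (rule Int_stable_path_events) auto
  show "path_events {{..n}} \<subseteq> events" by (rule path_events_in_events)
  show "?E \<in> events" "?H \<in> events" by (rule state_event)+
  have EH: "?E \<inter> ?H = {\<omega> \<in> space M. Z (Suc n) \<omega> = t \<and> Z n \<omega> = s}" by auto
  show "prob (?E \<inter> ?H) = ?c * prob ?E"
  proof (cases "prob ?E = 0")
    case True
    have "prob (?E \<inter> ?H) \<le> prob ?E"
      using state_event by (intro finite_measure_mono) auto
    then show ?thesis using True measure_nonneg[of M "?E \<inter> ?H"] by simp
  next
    case False
    then show ?thesis by (simp add: cond_prob_def EH)
  qed
  show "prob (X \<inter> ?E \<inter> ?H) = ?c * prob (X \<inter> ?E)" if X_path: "X \<in> path_events {{..n}}" for X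
  proof (cases "X \<inter> ?E = {}")
    case True
    then show ?thesis by simp
  next
    case False
    then obtain i where i: "X = path_event {..n} i" "\<forall>k\<le>n. i k \<in> S k"
      using X_path by (auto simp: path_events_def)
    have s: "i n = s" using False i by (auto simp: path_event_def)
    have XE: "X \<inter> ?E = X" and X: "X = {\<omega> \<in> space M. \<forall>k\<le>n. Z k \<omega> = i k}"
      and XH: "X \<inter> ?H = {\<omega> \<in> space M. Z (Suc n) \<omega> = t \<and> (\<forall>k\<le>n. Z k \<omega> = i k)}"
      using i s by (auto simp: path_event_def)
    show ?thesis
    proof (cases "prob X = 0")
      case True
      have "prob (X \<inter> ?H) \<le> prob X"
        using state_event path_event_in_events i by (intro finite_measure_mono) auto
      then show ?thesis using True measure_nonneg[of M "X \<inter> ?H"] by (simp add: XE)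
    next
      case False
      then have "prob X > 0" by (simp add: zero_less_measure_iff)
      then have "\<P>(\<omega> in M. Z (Suc n) \<omega> = t \<bar> \<forall>k\<le>n. Z k \<omega> = i k) = ?c"
        unfolding s[symmetric] using markov_step i(2) t X by simp
      then have "prob (X \<inter> ?H) / prob X = ?c"
        by (simp only: cond_prob_def XH X[symmetric])
      then show ?thesis using False by (simp add: XE field_simps)
    qed
  qed
  show "G \<in> sigma_sets (space M) (path_events {{..n}})"
    using G observable_subset_sigma_path_events[of "{{..n}}" "{..n}"] by auto
qed

text \<open>
  Cross-multiplied, the claim also covers the case that \<open>Z n = i n\<close> has probability zero.
  Extending a future path by one step multiplies both sides by the same transition
  probability, because the past together with the path so far is again a past event.
\<close>

lemma future_path_given_past:
  assumes G: "G \<in> observable {..n}" and i: "\<forall>k\<in>{n..n+m}. i k \<in> S k"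
  shows "prob (path_event {n..n+m} i \<inter> G) * prob {\<omega> \<in> space M. Z n \<omega> = i n}
       = prob (path_event {n..n+m} i) * prob (G \<inter> {\<omega> \<in> space M. Z n \<omega> = i n})"
  using i
proof (induction m)
  case 0
  have "path_event {n..n+0} i = {\<omega> \<in> space M. Z n \<omega> = i n}"
    by (auto simp: path_event_def)
  then show ?case by (simp add: Int_commute)
next
  case (Suc m)
  let ?l = "n + m"
  let ?p = "path_event {n..?l} i"
  let ?E = "{\<omega> \<in> space M. Z ?l \<omega> = i ?l}" and ?H = "{\<omega> \<in> space M. Z (Suc ?l) \<omega> = i (Suc ?l)}"
  let ?c = "\<P>(\<omega> in M. Z (Suc ?l) \<omega> = i (Suc ?l) \<bar> Z ?l \<omega> = i ?l)"
  have split: "path_event {n..n + Suc m} i = ?p \<inter> ?E \<inter> ?H"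
    by (auto simp: path_event_def le_Suc_eq)
  have pE: "?p \<inter> ?E = ?p" by (auto simp: path_event_def)
  have p: "?p \<in> observable {..?l}" by (rule path_event_observable) auto
  have pG: "?p \<inter> G \<in> observable {..?l}"
    using p G observable_mono[of "{..n}" "{..?l}"] by (intro observable_Int) auto
  have t: "i (Suc ?l) \<in> S (Suc ?l)" using Suc.prems by auto
  have 1: "prob (path_event {n..n + Suc m} i) = ?c * prob ?p"
    using transition_given_past[OF p t, of "i ?l"] unfolding split pE by simp
  have "?p \<inter> G \<inter> ?E = ?p \<inter> G" "path_event {n..n + Suc m} i \<inter> G = ?p \<inter> G \<inter> ?E \<inter> ?H"
    using pE split by auto
  then have 2: "prob (path_event {n..n + Suc m} i \<inter> G) = ?c * prob (?p \<inter> G)"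
    using transition_given_past[OF pG t, of "i ?l"] by simp
  show ?case
    using Suc.IH Suc.prems unfolding 1 2 by simp
qed

text \<open>
  Now the past event \<open>G\<close> is held fixed and the Dynkin argument runs over the future event,
  with \<open>P(G | Z n = s)\<close> as the constant factor. If \<open>s\<close> has probability zero, both sides
  vanish.
\<close>

lemma future_given_past:
  assumes A: "A \<in> observable {n..}" and G: "G \<in> observable {..n}"
  shows "prob (A \<inter> (G \<inter> {\<omega> \<in> space M. Z n \<omega> = s}))
       = \<P>(\<omega> in M. \<omega> \<in> A \<bar> Z n \<omega> = s) * prob (G \<inter> {\<omega> \<in> space M. Z n \<omega> = s})"
    (is "prob (A \<inter> (G \<inter> ?E)) = _")
proof (cases "prob ?E = 0")
  case True
  have ev: "A \<in> events" "G \<in> events" using A G observable_events by auto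
  have "prob (G \<inter> ?E) \<le> prob ?E" "prob (A \<inter> (G \<inter> ?E)) \<le> prob ?E"
    using ev state_event by (auto intro!: finite_measure_mono)
  then have "prob (G \<inter> ?E) = 0" "prob (A \<inter> (G \<inter> ?E)) = 0"
    using True by (auto simp: measure_le_0_iff)
  then show ?thesis by simp
next
  case False
  let ?\<J> = "{{n..n+m} | m. True}"
  let ?c = "prob (G \<inter> ?E) / prob ?E"
  have "prob (A \<inter> ?E \<inter> G) = ?c * prob (A \<inter> ?E)"
  proof (rule product_rule_extends_to_sigma_sets)
    show "Int_stable (path_events ?\<J>)"
      by (rule Int_stable_path_events) auto
    show "path_events ?\<J> \<subseteq> events" by (rule path_events_in_events)
    show "?E \<in> events" by (rule state_event)
    show "G \<in> events" using G observable_events by auto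
    show "prob (?E \<inter> G) = ?c * prob ?E" using False by (simp add: Int_commute)
    show "A \<in> sigma_sets (space M) (path_events ?\<J>)"
    proof -
      have "k \<in> {n..n + (k - n)}" if "n \<le> k" for k
        using that by auto
      then have "{n..} \<subseteq> \<Union>?\<J>" by blast
      then show ?thesis
        using A observable_subset_sigma_path_events[of ?\<J> "{n..}"] by auto
    qed
    show "prob (X \<inter> ?E \<inter> G) = ?c * prob (X \<inter> ?E)" if X_path: "X \<in> path_events ?\<J>" for X
    proof (cases "X \<inter> ?E = {}")
      case True
      then show ?thesis by simp
    next
      case nonempty: False
      then obtain m i where i: "X = path_event {n..n+m} i" "\<forall>k\<in>{n..n+m}. i k \<in> S k"
        using X_path by (auto simp: path_events_def)
      have s: "i n = s" using nonempty i by (auto simp: path_event_def)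
      have "X \<inter> ?E = X" using i s by (auto simp: path_event_def)
      then show ?thesis
        using future_path_given_past[OF G i(2)] False by (simp add: i(1) s field_simps)
    qed
  qed
  moreover have "{\<omega> \<in> space M. \<omega> \<in> A \<and> Z n \<omega> = s} = A \<inter> ?E"
    using A observable_events sets.sets_into_space by fastforce
  ultimately show ?thesis
    by (simp add: cond_prob_def Int_assoc Int_left_commute Int_commute)
qed

section \<open>Thresholding the conditional probability of a tail event\<close>

text \<open>
  A state where the conditional probability equals \<open>c\<close> may lie in \<open>T\<close> or outside, so that
  both the strict and the non-strict threshold are covered.
\<close>

lemma prob_sym_diff_threshold_le:
  assumes A: "A \<in> observable {n..}" and B: "B \<in> observable {..n}"
    and c: "0 < c" "c < 1"
    and above: "\<And>s. s \<in> T \<Longrightarrow> c \<le> \<P>(\<omega> in M. \<omega> \<in> A \<bar> Z n \<omega> = s)"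
    and below: "\<And>s. s \<in> S n - T \<Longrightarrow> \<P>(\<omega> in M. \<omega> \<in> A \<bar> Z n \<omega> = s) \<le> c"
  shows "prob (sym_diff {\<omega> \<in> space M. Z n \<omega> \<in> T} B) \<le> prob (A - B) / c + prob (B - A) / (1 - c)"
proof -
  let ?D = "{\<omega> \<in> space M. Z n \<omega> \<in> T}"
  let ?E = "\<lambda>s. {\<omega> \<in> space M. Z n \<omega> = s}"
  have D: "?D \<in> observable {..n}" by (rule preimage_observable) simp
  have ev: "A \<in> events" "B \<in> events" "?D \<in> events"
    using A B D observable_events by auto
  have DB: "?D - B \<in> observable {..n}" and BD: "B - ?D \<in> observable {..n}"
    using D B by (auto intro: observable_Diff)
  have "c * prob (?D - B) \<le> prob (A \<inter> (?D - B))"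
  proof (rule prob_le_by_countable_fibres[OF countable_states measurable_process])
    fix s
    show "c * prob ((?D - B) \<inter> ?E s) \<le> prob (A \<inter> (?D - B) \<inter> ?E s)"
    proof (cases "s \<in> T")
      case True
      then show ?thesis
        using future_given_past[OF A DB, of s] above[of s]
        by (simp add: Int_assoc mult_right_mono)
    next
      case False
      then have "(?D - B) \<inter> ?E s = {}" by auto
      then show ?thesis by simp
    qed
  qed (use ev c in auto)
  also have "\<dots> \<le> prob (A - B)"
    using ev by (intro finite_measure_mono) auto
  finally have 1: "prob (?D - B) \<le> prob (A - B) / c"
    using c by (simp add: field_simps)
  have "(1 - c) * prob (B - ?D) \<le> prob ((B - ?D) - A)"
  proof (rule prob_le_by_countable_fibres[OF countable_states measurable_process])
    fix s assume s: "s \<in> S n"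
    show "(1 - c) * prob ((B - ?D) \<inter> ?E s) \<le> prob (((B - ?D) - A) \<inter> ?E s)"
    proof (cases "s \<in> T")
      case False
      have "((B - ?D) - A) \<inter> ?E s = (B - ?D) \<inter> ?E s - A \<inter> ((B - ?D) \<inter> ?E s)" by auto
      also have "prob \<dots> = prob ((B - ?D) \<inter> ?E s) - prob (A \<inter> ((B - ?D) \<inter> ?E s))"
        using ev state_event by (intro finite_measure_Diff) auto
      finally have eq: "prob (((B - ?D) - A) \<inter> ?E s)
          = prob ((B - ?D) \<inter> ?E s) - prob (A \<inter> ((B - ?D) \<inter> ?E s))" .
      have "prob (A \<inter> ((B - ?D) \<inter> ?E s)) \<le> c * prob ((B - ?D) \<inter> ?E s)"
        unfolding future_given_past[OF A BD] using below s False
        by (intro mult_right_mono) auto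
      then show ?thesis unfolding eq by (simp add: algebra_simps)
    next
      case True
      then have "(B - ?D) \<inter> ?E s = {}"
        using ev sets.sets_into_space by auto
      then show ?thesis by simp
    qed
  qed (use ev c in auto)
  also have "\<dots> \<le> prob (B - A)"
    using ev by (intro finite_measure_mono) auto
  finally have 2: "prob (B - ?D) \<le> prob (B - A) / (1 - c)"
    using c by (simp add: field_simps)
  have "prob (sym_diff ?D B) \<le> prob (?D - B) + prob (B - ?D)"
    using ev by (intro measure_Un_le) auto
  then show ?thesis using 1 2 by simp
qed

lemma prob_threshold_tendsto:
  assumes A: "\<And>n. A \<in> observable {n..}"
    and c: "0 < c" "c < 1"
    and above: "\<And>n s. s \<in> T n \<Longrightarrow> c \<le> \<P>(\<omega> in M. \<omega> \<in> A \<bar> Z n \<omega> = s)"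
    and below: "\<And>n s. s \<in> S n - T n \<Longrightarrow> \<P>(\<omega> in M. \<omega> \<in> A \<bar> Z n \<omega> = s) \<le> c"
  shows "(\<lambda>n. \<P>(\<omega> in M. Z n \<omega> \<in> T n)) \<longlonglongrightarrow> prob A"
proof (rule LIMSEQ_I)
  fix e :: real assume e: "0 < e"
  \<comment> \<open>If \<open>A\<close> and \<open>B\<close> differ by \<open>d\<close> in probability, then \<open>A\<close> and the threshold event
    differ by at most \<open>K * d\<close>: by \<open>d / c + d / (1 - c)\<close> on the way to \<open>B\<close>, and by \<open>d\<close> from
    there to \<open>A\<close>.\<close>
  define K where "K = 1 / c + 1 / (1 - c) + 1"
  have K: "0 < K" using c by (auto simp: K_def intro!: add_pos_pos)
  have "observable {..i} \<subseteq> observable {..j}" if "i \<le> j" for i j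
    using that by (intro observable_mono) auto
  moreover have "A \<in> sigma_sets (space M) (\<Union>n. observable {..n})"
  proof -
    have "observable {0..} \<subseteq> sigma_sets (space M) (\<Union>n. observable {..n})"
      unfolding observable_def[of "{0..}"]
      by (rule sigma_sets_subseteq) (auto simp: observable_def intro!: sigma_sets.Basic)
    then show ?thesis using A by blast
  qed
  moreover have "0 < e / K" using e K by simp
  ultimately obtain m B where B: "B \<in> observable {..m}" "prob (sym_diff A B) < e / K"
    by (rule approximation_in_filtration[of "\<lambda>n. observable {..n}",
          OF sigma_algebra_observable observable_events])
  have ev: "A \<in> events" "B \<in> events" using A B observable_events by blast+
  show "\<exists>N. \<forall>n\<ge>N. norm (\<P>(\<omega> in M. Z n \<omega> \<in> T n) - prob A) < e"
  proof (intro exI allI impI)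
    fix n assume n: "m \<le> n"
    let ?D = "{\<omega> \<in> space M. Z n \<omega> \<in> T n}" and ?d = "prob (sym_diff A B)"
    have Bn: "B \<in> observable {..n}"
      using B(1) n observable_mono[of "{..m}" "{..n}"] by auto
    have D: "?D \<in> events" by (rule preimage_event)
    have d: "prob (A - B) \<le> ?d" "prob (B - A) \<le> ?d"
      using ev by (auto intro!: finite_measure_mono)
    have "\<bar>prob ?D - prob A\<bar> \<le> prob (sym_diff ?D A)"
      by (rule abs_prob_diff_le_prob_sym_diff[OF D ev(1)])
    also have "\<dots> \<le> prob (sym_diff ?D B) + prob (sym_diff B A)"
      by (rule prob_sym_diff_triangle[OF D ev(2,1)])
    also have "\<dots> \<le> prob (A - B) / c + prob (B - A) / (1 - c) + ?d"
      using prob_sym_diff_threshold_le[OF A Bn c above below, of "T n"]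
      by (simp add: Un_commute)
    also have "\<dots> \<le> ?d / c + ?d / (1 - c) + ?d"
      using d c by (intro add_mono divide_right_mono) auto
    also have "\<dots> = ?d * K" by (simp add: K_def algebra_simps)
    also have "\<dots> < e" using B(2) K by (simp add: field_simps)
    finally show "norm (prob ?D - prob A) < e" by simp
  qed
qed

end

theorem theorem1:
  fixes M :: "'a measure"
    and S :: "nat \<Rightarrow> 's set"
    and Z :: "nat \<Rightarrow> 'a \<Rightarrow> 's"
    and A :: "'a set"
    and p q :: real
  assumes "prob_space M"
    and "\<And>n. countable (S n)"
    and "markov_chain M S Z"
    and "A \<in> process_tail_events M S Z"
    and "0 < p" "p < q" "q < 1"
  shows "((\<lambda>n. \<P>(\<omega> in M. Z n \<omega> \<in> cond_prob_states M S Z A n q 1))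
           \<longlonglongrightarrow> measure M A) \<and>
         ((\<lambda>n. \<P>(\<omega> in M. Z n \<omega> \<in> cond_prob_states M S Z A n p q))
           \<longlonglongrightarrow> 0) \<and>
         ((\<lambda>n. \<P>(\<omega> in M. Z n \<omega> \<in> cond_prob_states M S Z A n 0 p))
           \<longlonglongrightarrow> 1 - measure M A)"
proof -
  interpret prob_space M by fact
  interpret countable_markov_chain M S Z
  proof
    show "countable (S n)" for n by fact
    show "Z n \<in> measurable M (count_space (S n))" for n
      using assms(3) by (simp add: markov_chain_def)
    show "markov_chain M S Z" by fact
  qed
  have A: "A \<in> observable {n..}" for n
    using assms(4) by (auto simp: process_tail_events_def tail_events_def observable_def)
  let ?f = "\<lambda>n s. \<P>(\<omega> in M. \<omega> \<in> A \<bar> Z n \<omega> = s)"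
  let ?ge = "\<lambda>c n. {s \<in> S n. c \<le> ?f n s}" and ?gt = "\<lambda>c n. {s \<in> S n. c < ?f n s}"
  have f: "0 \<le> ?f n s" "?f n s \<le> 1" for n s
  proof -
    show "0 \<le> ?f n s" by (simp add: cond_prob_def)
    have "\<P>(\<omega> in M. \<omega> \<in> A \<and> Z n \<omega> = s) \<le> \<P>(\<omega> in M. Z n \<omega> = s)"
      using state_event by (intro finite_measure_mono) auto
    then show "?f n s \<le> 1"
      by (simp add: cond_prob_def divide_le_eq_1 zero_less_measure_iff)
  qed
  have ge: "(\<lambda>n. \<P>(\<omega> in M. Z n \<omega> \<in> ?ge c n)) \<longlonglongrightarrow> prob A" if "0 < c" "c < 1" for c
    by (rule prob_threshold_tendsto[OF A that]) auto
  have gt: "(\<lambda>n. \<P>(\<omega> in M. Z n \<omega> \<in> ?gt c n)) \<longlonglongrightarrow> prob A" if "0 < c" "c < 1" for c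
    by (rule prob_threshold_tendsto[OF A that]) auto
  have pq: "p < 1" "0 < q" using assms by auto
  \<comment> \<open>The three sets of states are a threshold set, a difference of two, and a complement;
    both bounds being included in \<open>cond_prob_states\<close>, what is removed is cut off strictly.\<close>
  have "cond_prob_states M S Z A n q 1 = ?ge q n" for n
    using f by (auto simp: cond_prob_states_def)
  then have a: "(\<lambda>n. \<P>(\<omega> in M. Z n \<omega> \<in> cond_prob_states M S Z A n q 1)) \<longlonglongrightarrow> prob A"
    using ge[of q] pq assms by simp
  have "\<P>(\<omega> in M. Z n \<omega> \<in> cond_prob_states M S Z A n p q)
      = \<P>(\<omega> in M. Z n \<omega> \<in> ?ge p n) - \<P>(\<omega> in M. Z n \<omega> \<in> ?gt q n)" for n
  proof -
    have "{\<omega> \<in> space M. Z n \<omega> \<in> cond_prob_states M S Z A n p q}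
        = {\<omega> \<in> space M. Z n \<omega> \<in> ?ge p n} - {\<omega> \<in> space M. Z n \<omega> \<in> ?gt q n}"
      using process_in_states by (auto simp: cond_prob_states_def)
    also have "prob \<dots> = \<P>(\<omega> in M. Z n \<omega> \<in> ?ge p n) - \<P>(\<omega> in M. Z n \<omega> \<in> ?gt q n)"
      using assms by (intro finite_measure_Diff preimage_event) auto
    finally show ?thesis .
  qed
  then have b: "(\<lambda>n. \<P>(\<omega> in M. Z n \<omega> \<in> cond_prob_states M S Z A n p q)) \<longlonglongrightarrow> 0"
    using tendsto_diff[OF ge[of p] gt[of q]] pq assms by simp
  have "\<P>(\<omega> in M. Z n \<omega> \<in> cond_prob_states M S Z A n 0 p)
      = 1 - \<P>(\<omega> in M. Z n \<omega> \<in> ?gt p n)" for n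
  proof -
    have "{\<omega> \<in> space M. Z n \<omega> \<in> cond_prob_states M S Z A n 0 p}
        = space M - {\<omega> \<in> space M. Z n \<omega> \<in> ?gt p n}"
      using process_in_states f by (auto simp: cond_prob_states_def not_less)
    also have "prob \<dots> = 1 - \<P>(\<omega> in M. Z n \<omega> \<in> ?gt p n)"
      by (intro prob_compl preimage_event)
    finally show ?thesis .
  qed
  then have "(\<lambda>n. \<P>(\<omega> in M. Z n \<omega> \<in> cond_prob_states M S Z A n 0 p)) \<longlonglongrightarrow> 1 - prob A"
    using tendsto_diff[OF tendsto_const[of 1] gt[of p]] pq assms by simp
  with a b show ?thesis by simp
qed

end
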